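(* Let $G$ and $H$ be connected graphs with ${\rm rad}(G)\ge {\rm rad}(H)$, and let $p\ge 2$ be an integer. Then $(G\boxtimes H)^{[\natural p]}$ is connected if and only if both of the following hold: (1) ${\rm rad}(G)\ge p$; and (2) $G^{[\natural p]}$ is connected or ${\rm diam}(H)\ge p$.
   Context: For a graph $G$ and a positive integer $p$, $G^{[\natural p]}$ is the graph on $V(G)$ in which two vertices are adjacent iff their distance in $G$ is exactly $p$. ${\rm rad}$ and ${\rm diam}$ are the minimum and maximum eccentricity. The strong product $G\boxtimes H$ has vertex set $V(G)\times V(H)$, distinct vertices $(g_1,h_1),(g_2,h_2)$ being adjacent iff $g_1g_2\in E(G)$ and $h_1=h_2$, or $g_1=g_2$ and $h_1h_2\in E(H)$, or $g_1g_2\in E(G)$ and $h_1h_2\in E(H)$.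
   Formalization: The formal theorem additionally assumes that G and H are not both the one-vertex graph; for G = H = K1 the claim fails, since the exact distance-p graph of the product is K1, which is connected, while rad(G) = 0 < p. *)

theory Defs
  imports "Graph_Theory.Graph_Theory" "HOL-Library.Extended_Nat" "HOL-Library.Extended_Real"
begin

text \<open>
  A simple undirected graph, finite or infinite, is a \<^locale>\<open>pair_bidirected_digraph\<close>:
  a vertex set with a symmetric irreflexive relation on it. Distances, eccentricities,
  radius and diameter take values in \<^typ>\<open>enat\<close>, so that they also make sense when
  the graph is infinite or disconnected.
\<close>

definition graph_dist :: "'a pair_pre_digraph \<Rightarrow> 'a \<Rightarrow> 'a \<Rightarrow> enat" where
  "graph_dist G u v = (INF w\<in>{w. pre_digraph.awalk (with_proj G) u w v}. enat (length w))"

text \<open>Agreement with the library's weighted distance for unit weights.\<close>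

lemma graph_dist_eq_\<mu>:
  assumes "pair_wf_digraph G"
  shows "ereal_of_enat (graph_dist G u v) = wf_digraph.\<mu> (with_proj G) (\<lambda>_. 1) u v"
proof -
  interpret pair_wf_digraph G by fact
  have cost: "awalk_cost (\<lambda>_. 1) w = real (length w)" for w
    by (induction w) simp_all
  let ?W = "{w. awalk u w v}"
  show ?thesis
  proof (cases "?W = {}")
    case True
    then show ?thesis
      unfolding graph_dist_def \<mu>_def True by (simp add: top_ereal_def top_enat_def)
  next
    case False
    then obtain w\<^sub>0 where "w\<^sub>0 \<in> ?W"
      by blast
    then have "(INF w\<in>?W. enat (length w)) \<in> (\<lambda>w. enat (length w)) ` ?W"
      by (intro wellorder_InfI[of "enat (length w\<^sub>0)"] imageI)
    then obtain w where w: "w \<in> ?W" "(INF w\<in>?W. enat (length w)) = enat (length w)"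
      by auto
    have "length w \<le> length w'" if "w' \<in> ?W" for w'
      using INF_lower[OF that, of "\<lambda>w. enat (length w)"] w(2) by simp
    with w(1) have "\<mu> (\<lambda>_. 1) u v = ereal (real (length w))"
      unfolding \<mu>_def cost by (intro antisym INF_greatest INF_lower2[of w]) auto
    with w(2) show ?thesis
      unfolding graph_dist_def by simp
  qed
qed

definition eccentricity :: "'a pair_pre_digraph \<Rightarrow> 'a \<Rightarrow> enat" where
  "eccentricity G u = (SUP v\<in>pverts G. graph_dist G u v)"

text \<open>As \<^typ>\<open>enat\<close> is well-ordered, the infimum over a nonempty vertex set is a minimum.\<close>

definition rad :: "'a pair_pre_digraph \<Rightarrow> enat" where
  "rad G = (INF u\<in>pverts G. eccentricity G u)"

definition diam :: "'a pair_pre_digraph \<Rightarrow> enat" where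
  "diam G = (SUP u\<in>pverts G. eccentricity G u)"

definition exact_distance_graph :: "'a pair_pre_digraph \<Rightarrow> nat \<Rightarrow> 'a pair_pre_digraph" where
  "exact_distance_graph G p =
     \<lparr> pverts = pverts G,
       parcs = {(u, v). u \<in> pverts G \<and> v \<in> pverts G \<and> graph_dist G u v = enat p} \<rparr>"

definition strong_product ::
    "'a pair_pre_digraph \<Rightarrow> 'b pair_pre_digraph \<Rightarrow> ('a \<times> 'b) pair_pre_digraph"
    (infixl \<open>\<boxtimes>\<close> 70) where
  "G \<boxtimes> H =
     \<lparr> pverts = pverts G \<times> pverts H,
       parcs = {((g1, h1), (g2, h2)).
          (g1, g2) \<in> parcs G \<and> h1 = h2 \<and> h1 \<in> pverts H \<or>
          g1 = g2 \<and> g1 \<in> pverts G \<and> (h1, h2) \<in> parcs H \<or>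
          (g1, g2) \<in> parcs G \<and> (h1, h2) \<in> parcs H} \<rparr>"

lemma pair_bidirected_digraph_strong_product:
  assumes "pair_bidirected_digraph G" "pair_bidirected_digraph H"
  shows "pair_bidirected_digraph (G \<boxtimes> H)"
proof -
  interpret G: pair_bidirected_digraph G by fact
  interpret H: pair_bidirected_digraph H by fact
  have sym: "(b, a) \<in> parcs G" if "(a, b) \<in> parcs G" for a b
    using that G.pair_sym_arcs by (auto simp: symmetric_def dest: symD)
  have sym': "(b, a) \<in> parcs H" if "(a, b) \<in> parcs H" for a b
    using that H.pair_sym_arcs by (auto simp: symmetric_def dest: symD)
  show ?thesis
    by unfold_locales
       (auto simp: strong_product_def symmetric_def sym_def
             dest: G.wellformed' H.wellformed' G.pair_no_loops H.pair_no_loops sym sym')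
qed

end

theory Submission
  imports Defs
begin

text \<open>
  Distances in \<open>G \<boxtimes> H\<close> are maxima of the distances of the coordinates. Hence a vertex built from
  central vertices is isolated in the exact distance graph when \<open>rad G < p\<close>, and if \<open>diam H < p\<close> every
  edge of the exact distance graph projects to an edge of that of \<open>G\<close>. Conversely, if
  \<open>rad G \<ge> p\<close>, then each \<open>g\<close> has some \<open>g'\<close> at distance \<open>p\<close>, so for adjacent \<open>h, h'\<close> the path
  \<open>(g, h), (g', h), (g, h')\<close> shows that each layer \<open>{g} \<times> V(H)\<close> lies in one component. Two layers
  over \<open>g\<close> and \<open>g'\<close> are joined directly if \<open>g, g'\<close> are at distance \<open>p\<close>, and, if \<open>h, h'\<close> are at distance
  \<open>p\<close>, by the edge from \<open>(g, h)\<close> to \<open>(g', h')\<close> whenever \<open>g, g'\<close> are adjacent.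
\<close>

section \<open>Connectivity and distance through powers of the arc relation\<close>

lemma (in pair_sym_digraph) connected_iff_rtrancl:
  "Digraph_Component.connected (with_proj G) \<longleftrightarrow>
     pverts G \<noteq> {} \<and> (\<forall>u\<in>pverts G. \<forall>v\<in>pverts G. (u, v) \<in> (parcs G)\<^sup>*)"
proof -
  have "(u, v) \<in> rtrancl_on (pverts G) (parcs G) \<longleftrightarrow> (u, v) \<in> (parcs G)\<^sup>*"
    if "u \<in> pverts G" "v \<in> pverts G" for u v
    using that rtrancl_consistent_rtrancl_on[of u v "parcs G" "pverts G"] rtrancl_on_rtranclI
    by (metis arc_snd_in_verts snd_conv)
  then have "u \<rightarrow>\<^sup>*\<^bsub>with_proj G\<^esub> v \<longleftrightarrow> (u, v) \<in> (parcs G)\<^sup>*"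
    if "u \<in> pverts G" "v \<in> pverts G" for u v
    using that by (simp add: reachable_def)
  \<comment> \<open>The library defines connectivity via the symmetrisation, which changes nothing
    here since the arcs are symmetric.\<close>
  then show ?thesis
    using reachable_mk_symmetric_eq[OF pair_sym_arcs]
    unfolding Digraph_Component.connected_def strongly_connected_def by simp
qed

lemma relpow_Suc_iff2: "(x, y) \<in> r ^^ Suc n \<longleftrightarrow> (\<exists>z. (x, z) \<in> r \<and> (z, y) \<in> r ^^ n)"
  by (meson relpow_Suc_I2 relpow_Suc_D2)

lemma (in pair_wf_digraph) awalk_length_iff_relpow:
  "(\<exists>w. awalk u w v \<and> length w = n) \<longleftrightarrow> u \<in> pverts G \<and> (u, v) \<in> parcs G ^^ n"
proof (induction n arbitrary: u)
  case 0
  then show ?case by (auto simp: awalk_Nil_iff)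
next
  case (Suc n)
  have "(\<exists>w. awalk u w v \<and> length w = Suc n) \<longleftrightarrow> (\<exists>e w. awalk u (e # w) v \<and> length w = n)"
    by (metis length_Suc_conv)
  also have "\<dots> \<longleftrightarrow> (\<exists>x. (u, x) \<in> parcs G \<and> (\<exists>w. awalk x w v \<and> length w = n))"
    by (auto simp: awalk_Cons_iff)
  also have "\<dots> \<longleftrightarrow> (\<exists>x. (u, x) \<in> parcs G \<and> (x, v) \<in> parcs G ^^ n)"
    unfolding Suc using arc_snd_in_verts by fastforce
  also have "\<dots> \<longleftrightarrow> u \<in> pverts G \<and> (u, v) \<in> parcs G ^^ Suc n"
    unfolding relpow_Suc_iff2 using arc_fst_in_verts by fastforce
  finally show ?case .
qed

text \<open>Padding: once standing still is allowed, a walk of at most \<open>n\<close> arcs becomes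
  one of exactly \<open>n\<close> steps.\<close>

lemma relpow_reflcl_eq: "(r\<^sup>=) ^^ n = (\<Union>k\<le>n. r ^^ k)"
proof (induction n)
  case (Suc n)
  have "(r\<^sup>=) ^^ Suc n = (\<Union>k\<le>n. r ^^ Suc k) \<union> (\<Union>k\<le>n. r ^^ k)"
    using Suc by auto
  also have "\<dots> = (\<Union>k\<in>Suc ` {..n} \<union> {..n}. r ^^ k)"
    by blast
  also have "Suc ` {..n} \<union> {..n} = {..Suc n}"
    by (auto simp: atMost_Suc)
  finally show ?case .
qed auto

text \<open>Bounds on distances become relation powers, so no shortest walks need to be handled
  later. The condition on \<open>u\<close> excludes the loops that the reflexive closure has outside
  the graph.\<close>

lemma (in pair_wf_digraph) graph_dist_le_iff:
  "graph_dist G u v \<le> enat n \<longleftrightarrow> u \<in> pverts G \<and> (u, v) \<in> ((parcs G)\<^sup>=) ^^ n"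
proof -
  \<comment> \<open>The strict form is used because an infimum lies strictly below a value iff some
    member does.\<close>
  have "graph_dist G u v \<le> enat n \<longleftrightarrow> graph_dist G u v < enat (Suc n)"
    by (cases "graph_dist G u v") auto
  also have "\<dots> \<longleftrightarrow> (\<exists>k\<le>n. \<exists>w. awalk u w v \<and> length w = k)"
    unfolding graph_dist_def by (auto simp: INF_less_iff less_Suc_eq_le)
  also have "\<dots> \<longleftrightarrow> u \<in> pverts G \<and> (u, v) \<in> ((parcs G)\<^sup>=) ^^ n"
    unfolding awalk_length_iff_relpow relpow_reflcl_eq by auto
  finally show ?thesis .
qed

lemma enat_eqI_le: "(\<And>n. x \<le> enat n \<longleftrightarrow> y \<le> enat n) \<Longrightarrow> x = y"
  by (cases x; cases y) (auto intro: antisym)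

lemma sym_relpow: "sym r \<Longrightarrow> sym (r ^^ n)"
proof (induction n)
  case (Suc n)
  show ?case
  proof (rule symI)
    fix x y
    assume "(x, y) \<in> r ^^ Suc n"
    then obtain z where "(x, z) \<in> r ^^ n" "(z, y) \<in> r" by auto
    then have "(y, z) \<in> r" "(z, x) \<in> r ^^ n"
      using Suc by (auto dest: symD)
    then show "(y, x) \<in> r ^^ Suc n" by (rule relpow_Suc_I2)
  qed
qed (simp add: sym_Id)

section \<open>Distances in a single graph\<close>

context pair_sym_digraph
begin

lemma graph_dist_commute:
  assumes "u \<in> pverts G" "v \<in> pverts G"
  shows "graph_dist G u v = graph_dist G v u"
proof (rule enat_eqI_le)
  fix n
  have "sym ((parcs G)\<^sup>=)"
    using pair_sym_arcs by (auto simp: symmetric_def sym_def)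
  then show "graph_dist G u v \<le> enat n \<longleftrightarrow> graph_dist G v u \<le> enat n"
    using assms by (auto simp: graph_dist_le_iff dest: symD[OF sym_relpow])
qed

lemma pair_sym_digraph_exact_distance_graph: "pair_sym_digraph (exact_distance_graph G p)"
  by unfold_locales
     (auto simp: exact_distance_graph_def symmetric_def sym_def graph_dist_commute)

lemma connected_imp_graph_dist_finite:
  assumes "Digraph_Component.connected (with_proj G)" "u \<in> pverts G" "v \<in> pverts G"
  obtains n where "graph_dist G u v = enat n"
proof -
  have "(u, v) \<in> (parcs G)\<^sup>*"
    using assms by (simp add: connected_iff_rtrancl)
  then obtain n where "(u, v) \<in> ((parcs G)\<^sup>=) ^^ n"
    by (metis rtrancl_reflcl rtrancl_imp_relpow)
  then have "graph_dist G u v \<le> enat n"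
    using assms by (simp add: graph_dist_le_iff)
  with that show ?thesis
    by (cases "graph_dist G u v") auto
qed

lemma graph_dist_eq_0: "u \<in> pverts G \<Longrightarrow> graph_dist G u u = 0"
  using graph_dist_le_iff[of u u 0] by (simp add: zero_enat_def[symmetric])

lemma graph_dist_arc_le:
  assumes "(u, v) \<in> parcs G"
  shows "graph_dist G u v \<le> 1"
  using assms graph_dist_le_iff[of u v 1] arc_fst_in_verts by (fastforce simp: one_enat_def)

text \<open>A discrete intermediate value argument: cut a shortest walk to a vertex at distance at
  least \<open>p\<close> after \<open>p\<close> steps.\<close>

lemma ex_graph_dist_eq:
  assumes "Digraph_Component.connected (with_proj G)"
    and "u \<in> pverts G" "enat p \<le> eccentricity G u"
  obtains v where "v \<in> pverts G" "graph_dist G u v = enat p"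
proof (cases p)
  case 0
  with assms that show ?thesis by (simp add: graph_dist_eq_0 zero_enat_def)
next
  case (Suc q)
  \<comment> \<open>In an infinite graph the supremum may not be attained; the strict bound still
    yields a vertex farther than \<open>q\<close>, hence at distance at least
    \<open>p\<close>.\<close>
  then have "enat q < eccentricity G u"
    using assms(3) by (metis Suc_ile_eq)
  then obtain x where x: "x \<in> pverts G" "enat q < graph_dist G u x"
    unfolding eccentricity_def by (auto simp: less_SUP_iff)
  obtain n where n: "graph_dist G u x = enat n"
    using connected_imp_graph_dist_finite assms x(1) by metis
  with x(2) Suc have "n = p + (n - p)" "p \<le> n" by auto
  moreover have "(u, x) \<in> ((parcs G)\<^sup>=) ^^ n"
    using n graph_dist_le_iff by (metis order_refl)
  ultimately have "(u, x) \<in> ((parcs G)\<^sup>=) ^^ p O ((parcs G)\<^sup>=) ^^ (n - p)"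
    by (simp flip: relpow_add)
  then obtain v where v: "(u, v) \<in> ((parcs G)\<^sup>=) ^^ p" "(v, x) \<in> ((parcs G)\<^sup>=) ^^ (n - p)"
    by blast
  have "graph_dist G u v \<le> enat p"
    using v assms by (simp add: graph_dist_le_iff)
  \<comment> \<open>A shorter route to \<open>v\<close>, continued by the rest of the walk, would
    reach \<open>x\<close> in fewer than \<open>n\<close> steps.\<close>
  moreover have "\<not> graph_dist G u v \<le> enat q"
  proof
    assume "graph_dist G u v \<le> enat q"
    then have "(u, x) \<in> ((parcs G)\<^sup>=) ^^ (q + (n - p))"
      using v(2) by (auto simp: graph_dist_le_iff relpow_add)
    then have "graph_dist G u x \<le> enat (q + (n - p))"
      using assms by (simp add: graph_dist_le_iff)
    with n Suc \<open>p \<le> n\<close> show False by simp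
  qed
  ultimately have "graph_dist G u v = enat p"
    using Suc by (cases "graph_dist G u v") auto
  moreover have "v \<in> pverts G"
  proof -
    have "(u, v) \<in> (parcs G)\<^sup>*"
      using relpow_imp_rtrancl[OF v(1)] by simp
    then show ?thesis
      by (rule rtranclE) (use assms(2) arc_snd_in_verts in fastforce)+
  qed
  ultimately show ?thesis using that by blast
qed

end

section \<open>Distances in the strong product\<close>

lemma relpow_reflcl_strong_product:
  assumes "pair_wf_digraph G" "pair_wf_digraph H" "g \<in> pverts G" "h \<in> pverts H"
  shows "((g, h), (g', h')) \<in> ((parcs (G \<boxtimes> H))\<^sup>=) ^^ n \<longleftrightarrow>
    (g, g') \<in> ((parcs G)\<^sup>=) ^^ n \<and> (h, h') \<in> ((parcs H)\<^sup>=) ^^ n"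
  using assms(3,4)
proof (induction n arbitrary: g h)
  case 0
  then show ?case by auto
next
  case (Suc n)
  interpret G: pair_wf_digraph G by fact
  interpret H: pair_wf_digraph H by fact
  \<comment> \<open>With loops added, the three kinds of product arcs merge into independent steps
    in both coordinates, so padded walks split into pairs of padded walks of the same
    length.\<close>
  have step: "((g, h), (a, b)) \<in> (parcs (G \<boxtimes> H))\<^sup>= \<longleftrightarrow>
      (g, a) \<in> (parcs G)\<^sup>= \<and> (h, b) \<in> (parcs H)\<^sup>=" for a b
    using Suc.prems by (auto simp: strong_product_def)
  have verts: "a \<in> pverts G" "b \<in> pverts H"
    if "(g, a) \<in> (parcs G)\<^sup>=" "(h, b) \<in> (parcs H)\<^sup>=" for a b
    using that Suc.prems G.arc_snd_in_verts H.arc_snd_in_verts by fastforce+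
  have "((g, h), (g', h')) \<in> ((parcs (G \<boxtimes> H))\<^sup>=) ^^ Suc n \<longleftrightarrow>
      (\<exists>a b. (g, a) \<in> (parcs G)\<^sup>= \<and> (h, b) \<in> (parcs H)\<^sup>= \<and>
        ((a, b), (g', h')) \<in> ((parcs (G \<boxtimes> H))\<^sup>=) ^^ n)"
    unfolding relpow_Suc_iff2 split_paired_Ex step by blast
  also have "\<dots> \<longleftrightarrow> (\<exists>a b. (g, a) \<in> (parcs G)\<^sup>= \<and> (h, b) \<in> (parcs H)\<^sup>= \<and>
      (a, g') \<in> ((parcs G)\<^sup>=) ^^ n \<and> (b, h') \<in> ((parcs H)\<^sup>=) ^^ n)"
    using Suc.IH verts by meson
  also have "\<dots> \<longleftrightarrow> (g, g') \<in> ((parcs G)\<^sup>=) ^^ Suc n \<and> (h, h') \<in> ((parcs H)\<^sup>=) ^^ Suc n"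
    unfolding relpow_Suc_iff2 by blast
  finally show ?case .
qed

lemma graph_dist_strong_product:
  assumes "pair_bidirected_digraph G" "pair_bidirected_digraph H" "g \<in> pverts G" "h \<in> pverts H"
  shows "graph_dist (G \<boxtimes> H) (g, h) (g', h') = max (graph_dist G g g') (graph_dist H h h')"
proof (rule enat_eqI_le)
  fix n
  interpret G: pair_bidirected_digraph G by fact
  interpret H: pair_bidirected_digraph H by fact
  interpret GH: pair_bidirected_digraph "G \<boxtimes> H"
    using assms by (intro pair_bidirected_digraph_strong_product)
  have "(g, h) \<in> pverts (G \<boxtimes> H)"
    using assms by (simp add: strong_product_def)
  then show "graph_dist (G \<boxtimes> H) (g, h) (g', h') \<le> enat n \<longleftrightarrow>
      max (graph_dist G g g') (graph_dist H h h') \<le> enat n"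
    using assms(3,4) relpow_reflcl_strong_product[OF G.pair_wf_digraph_axioms H.pair_wf_digraph_axioms]
    by (simp add: G.graph_dist_le_iff H.graph_dist_le_iff GH.graph_dist_le_iff)
qed

lemma parcs_exact_distance_strong_product:
  assumes "pair_bidirected_digraph G" "pair_bidirected_digraph H"
  shows "((g, h), (g', h')) \<in> parcs (exact_distance_graph (G \<boxtimes> H) p) \<longleftrightarrow>
    g \<in> pverts G \<and> g' \<in> pverts G \<and> h \<in> pverts H \<and> h' \<in> pverts H \<and>
    max (graph_dist G g g') (graph_dist H h h') = enat p"
  using graph_dist_strong_product[OF assms]
  by (auto simp: exact_distance_graph_def strong_product_def)

section \<open>The radius and the two directions of the equivalence\<close>

lemma rad_le_eccentricity: "u \<in> pverts G \<Longrightarrow> rad G \<le> eccentricity G u"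
  unfolding rad_def by (rule INF_lower)

lemma ex_eccentricity_eq_rad:
  assumes "pverts G \<noteq> {}"
  obtains u where "u \<in> pverts G" "eccentricity G u = rad G"
proof -
  obtain u0 where "u0 \<in> pverts G" using assms by blast
  then have "rad G \<in> eccentricity G ` pverts G"
    unfolding rad_def by (intro wellorder_InfI[of "eccentricity G u0"] imageI)
  with that show ?thesis by auto
qed

text \<open>Two one-vertex factors are excluded: their product has a single vertex, so its exact
  distance graph is connected although both radii are 0.\<close>

theorem theorem3p2:
  fixes G :: "'a pair_pre_digraph" and H :: "'b pair_pre_digraph" and p :: nat
  assumes "pair_bidirected_digraph G" and "Digraph_Component.connected (with_proj G)"
    and "pair_bidirected_digraph H" and "Digraph_Component.connected (with_proj H)"
    and "\<not> (is_singleton (pverts G) \<and> is_singleton (pverts H))"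
    and "rad G \<ge> rad H"
    and "p \<ge> 2"
  shows "Digraph_Component.connected (with_proj (exact_distance_graph (G \<boxtimes> H) p)) \<longleftrightarrow>
           rad G \<ge> enat p \<and>
           (Digraph_Component.connected (with_proj (exact_distance_graph G p)) \<or> diam H \<ge> enat p)"
proof -
  interpret G: pair_bidirected_digraph G by fact
  interpret H: pair_bidirected_digraph H by fact
  interpret GH: pair_bidirected_digraph "G \<boxtimes> H"
    using assms by (intro pair_bidirected_digraph_strong_product)
  interpret Gp: pair_sym_digraph "exact_distance_graph G p"
    by (rule G.pair_sym_digraph_exact_distance_graph)
  interpret GHp: pair_sym_digraph "exact_distance_graph (G \<boxtimes> H) p"
    by (rule GH.pair_sym_digraph_exact_distance_graph)
  let ?E = "parcs (exact_distance_graph (G \<boxtimes> H) p)"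
  have E_iff: "((g, h), (g', h')) \<in> ?E \<longleftrightarrow>
      g \<in> pverts G \<and> g' \<in> pverts G \<and> h \<in> pverts H \<and> h' \<in> pverts H \<and>
      max (graph_dist G g g') (graph_dist H h h') = enat p" for g h g' h'
    by (rule parcs_exact_distance_strong_product) fact+
  have EG_iff: "(g, g') \<in> parcs (exact_distance_graph G p) \<longleftrightarrow>
      g \<in> pverts G \<and> g' \<in> pverts G \<and> graph_dist G g g' = enat p" for g g'
    by (simp add: exact_distance_graph_def)
  have V: "pverts (exact_distance_graph (G \<boxtimes> H) p) = pverts G \<times> pverts H"
    by (simp add: exact_distance_graph_def strong_product_def)
  have VGp: "pverts (exact_distance_graph G p) = pverts G"
    by (simp add: exact_distance_graph_def)
  have ne: "pverts G \<noteq> {}" "pverts H \<noteq> {}"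
    using assms G.connected_iff_rtrancl H.connected_iff_rtrancl by auto
  have reachG: "(u, v) \<in> (parcs G)\<^sup>*" if "u \<in> pverts G" "v \<in> pverts G" for u v
    using assms that G.connected_iff_rtrancl by blast
  have reachH: "(u, v) \<in> (parcs H)\<^sup>*" if "u \<in> pverts H" "v \<in> pverts H" for u v
    using assms that H.connected_iff_rtrancl by blast
  show ?thesis
  proof
    assume "Digraph_Component.connected (with_proj (exact_distance_graph (G \<boxtimes> H) p))"
    then have reach: "(x, y) \<in> ?E\<^sup>*" if "x \<in> pverts G \<times> pverts H" "y \<in> pverts G \<times> pverts H" for x y
      using that unfolding GHp.connected_iff_rtrancl V by blast
    have "enat p \<le> rad G"
    proof -
      obtain g where g: "g \<in> pverts G" "eccentricity G g = rad G"
        using ne(1) by (rule ex_eccentricity_eq_rad)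
      obtain h where h: "h \<in> pverts H" "eccentricity H h = rad H"
        using ne(2) by (rule ex_eccentricity_eq_rad)
      \<comment> \<open>A second vertex forces a path out of the central vertex
        \<open>(g, h)\<close>, and so an edge at it.\<close>
      have "pverts G \<times> pverts H \<noteq> {(g, h)}"
      proof
        assume "pverts G \<times> pverts H = {(g, h)}"
        then have "pverts G = {g}" "pverts H = {h}"
          using ne by blast+
        with assms(5) show False by simp
      qed
      then obtain y where "y \<in> pverts G \<times> pverts H" "y \<noteq> (g, h)"
        using g(1) h(1) by blast
      with reach[of "(g, h)" y] g(1) h(1) obtain z where "((g, h), z) \<in> ?E"
        by (metis SigmaI converse_rtranclE)
      then obtain g' h' where
        "g' \<in> pverts G" "h' \<in> pverts H" "max (graph_dist G g g') (graph_dist H h h') = enat p"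
        by (cases z) (auto simp: E_iff)
      \<comment> \<open>By centrality the maximum, which is \<open>p\<close>, is at most the larger
        radius, that of \<open>G\<close>.\<close>
      moreover from this have "graph_dist G g g' \<le> rad G" "graph_dist H h h' \<le> rad H"
        unfolding g(2)[symmetric] h(2)[symmetric] eccentricity_def by (auto intro: SUP_upper)
      ultimately show ?thesis
        using assms(6) by (auto simp: max_def split: if_splits)
    qed
    moreover have "Digraph_Component.connected (with_proj (exact_distance_graph G p))"
      if "\<not> enat p \<le> diam H"
    proof -
      have "graph_dist H h h' < enat p" if "h \<in> pverts H" "h' \<in> pverts H" for h h'
      proof -
        have "graph_dist H h h' \<le> eccentricity H h"
          unfolding eccentricity_def using that by (intro SUP_upper)
        also have "\<dots> \<le> diam H"
          unfolding diam_def using that by (intro SUP_upper)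
        finally show ?thesis using \<open>\<not> enat p \<le> diam H\<close> by simp
      qed
      \<comment> \<open>The maximum is \<open>p\<close> but the second distance is smaller, so the
        first one is \<open>p\<close>.\<close>
      then have "(g, g') \<in> parcs (exact_distance_graph G p)" if "((g, h), (g', h')) \<in> ?E" for g h g' h'
        using that unfolding E_iff EG_iff by (metis less_irrefl max_def)
      then have step: "(fst x, fst y) \<in> parcs (exact_distance_graph G p)" if "(x, y) \<in> ?E" for x y
        using that by (metis prod.collapse)
      have proj: "(fst x, fst y) \<in> (parcs (exact_distance_graph G p))\<^sup>*" if "(x, y) \<in> ?E\<^sup>*" for x y
        using that by (induction rule: rtrancl_induct) (auto intro: rtrancl_into_rtrancl step)
      obtain h where "h \<in> pverts H"
        using ne(2) by blast
      then have "(g, g') \<in> (parcs (exact_distance_graph G p))\<^sup>*"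
        if "g \<in> pverts G" "g' \<in> pverts G" for g g'
        using that proj[OF reach[of "(g, h)" "(g', h)"]] by simp
      with ne(1) show ?thesis
        unfolding Gp.connected_iff_rtrancl VGp by blast
    qed
    ultimately show "enat p \<le> rad G \<and>
        (Digraph_Component.connected (with_proj (exact_distance_graph G p)) \<or> enat p \<le> diam H)"
      by blast
  next
    assume R: "enat p \<le> rad G \<and>
        (Digraph_Component.connected (with_proj (exact_distance_graph G p)) \<or> enat p \<le> diam H)"
    have far: "\<exists>g'\<in>pverts G. graph_dist G g g' = enat p" if "g \<in> pverts G" for g
      using G.ex_graph_dist_eq[OF assms(2) that] rad_le_eccentricity[OF that] R
      by (metis order_trans)
    \<comment> \<open>A step along an arc of one factor cannot push the maximum above
      \<open>p\<close>.\<close>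
    have small: "x \<le> enat p" if "x \<le> 1" for x
      using that assms(7) by (cases x) (auto simp: one_enat_def)
    have layer_step: "((g, h), (g, h')) \<in> ?E\<^sup>*" if "g \<in> pverts G" "(h, h') \<in> parcs H" for g h h'
    proof -
      have hV: "h \<in> pverts H" "h' \<in> pverts H"
        using that(2) H.arc_fst_in_verts H.arc_snd_in_verts by fastforce+
      obtain g' where g': "g' \<in> pverts G" "graph_dist G g g' = enat p"
        using far \<open>g \<in> pverts G\<close> by blast
      have "((g, h), (g', h)) \<in> ?E"
        using g' that hV by (simp add: E_iff H.graph_dist_eq_0)
      moreover have "((g', h), (g, h')) \<in> ?E"
        using g' that hV small[OF H.graph_dist_arc_le[OF that(2)]]
        by (simp add: E_iff G.graph_dist_commute[of g' g])
      ultimately show ?thesis by (meson converse_rtrancl_into_rtrancl r_into_rtrancl)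
    qed
    have layer: "((g, h), (g, h')) \<in> ?E\<^sup>*"
      if "g \<in> pverts G" "h \<in> pverts H" "h' \<in> pverts H" for g h h'
      using reachH[OF that(2,3)]
    proof (induction rule: rtrancl_induct)
      case (step y z)
      then show ?case using layer_step[OF that(1)] by (meson rtrancl_trans)
    qed simp
    \<comment> \<open>The relation \<open>A\<close> is kept abstract to serve both cases: it becomes
      the arcs of the exact distance graph of \<open>G\<close>, or those of \<open>G\<close> itself.
      Generalising \<open>h'\<close> lets the induction hypothesis end at the point \<open>x\<close>
      where the next edge leaves its layer.\<close>
    have join: "((g, h), (g', h')) \<in> ?E\<^sup>*"
      if "(g, g') \<in> A\<^sup>*" and "g \<in> pverts G" "h \<in> pverts H" "h' \<in> pverts H"
        and A: "\<And>a b. (a, b) \<in> A \<Longrightarrow> a \<in> pverts G \<and> b \<in> pverts G \<and>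
                 (\<exists>x\<in>pverts H. \<exists>y\<in>pverts H. ((a, x), (b, y)) \<in> ?E)"
      for A g g' h h'
      using that(1,4)
    proof (induction arbitrary: h' rule: rtrancl_induct)
      case base
      then show ?case using layer that by blast
    next
      case (step a b)
      then obtain x y where "x \<in> pverts H" "y \<in> pverts H" "((a, x), (b, y)) \<in> ?E" "b \<in> pverts G"
        using A by blast
      with step show ?case
        using layer[of b y h'] by (meson rtrancl_into_rtrancl rtrancl_trans)
    qed
    have "((g, h), (g', h')) \<in> ?E\<^sup>*"
      if "g \<in> pverts G" "g' \<in> pverts G" "h \<in> pverts H" "h' \<in> pverts H" for g g' h h'
      using R[THEN conjunct2]
    proof
      assume "Digraph_Component.connected (with_proj (exact_distance_graph G p))"
      then have "(g, g') \<in> (parcs (exact_distance_graph G p))\<^sup>*"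
        using that by (simp add: Gp.connected_iff_rtrancl VGp)
      then show ?thesis
      proof (rule join)
        fix a b
        \<comment> \<open>The edge lifts with second coordinate fixed at \<open>h\<close>, where the
          distance in \<open>H\<close> is 0.\<close>
        assume "(a, b) \<in> parcs (exact_distance_graph G p)"
        then show "a \<in> pverts G \<and> b \<in> pverts G \<and>
            (\<exists>x\<in>pverts H. \<exists>y\<in>pverts H. ((a, x), (b, y)) \<in> ?E)"
          using that(3) by (auto simp: E_iff EG_iff H.graph_dist_eq_0 intro!: bexI[of _ h])
      qed (use that in auto)
    next
      assume "enat p \<le> diam H"
      \<comment> \<open>As for eccentricities, the strict bound copes with a supremum that may not
        be attained.\<close>
      then obtain q where q: "p = Suc q" "enat q < diam H"
        using assms(7) by (cases p) (auto simp: Suc_ile_eq)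
      then obtain x where x: "x \<in> pverts H" "enat q < eccentricity H x"
        unfolding diam_def by (auto simp: less_SUP_iff)
      then have "enat p \<le> eccentricity H x"
        by (simp add: q Suc_ile_eq)
      then obtain y where y: "y \<in> pverts H" "graph_dist H x y = enat p"
        using H.ex_graph_dist_eq[OF assms(4) x(1)] by metis
      show ?thesis
      \<comment> \<open>The single pair \<open>x\<close>, \<open>y\<close> at distance
        \<open>p\<close> serves every arc of \<open>G\<close>.\<close>
      proof (rule join[OF reachG])
        fix a b
        assume ab: "(a, b) \<in> parcs G"
        then have "a \<in> pverts G" "b \<in> pverts G"
          using G.arc_fst_in_verts G.arc_snd_in_verts by fastforce+
        moreover from this have "((a, x), (b, y)) \<in> ?E"
          using x y small[OF G.graph_dist_arc_le[OF ab]] by (simp add: E_iff max_absorb2)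
        ultimately show "a \<in> pverts G \<and> b \<in> pverts G \<and>
            (\<exists>x\<in>pverts H. \<exists>y\<in>pverts H. ((a, x), (b, y)) \<in> ?E)"
          using x y by blast
      qed (use that in auto)
    qed
    then show "Digraph_Component.connected (with_proj (exact_distance_graph (G \<boxtimes> H) p))"
      using ne by (auto simp: GHp.connected_iff_rtrancl V)
  qed
qed

end
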